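(* Let $n\ge 4$ be an even integer and $R_n^3=\langle (n-1)^3,n^3,(n+1)^3\rangle$. The matrix of minimal relations $\mathcal{A}$ of $R_n^3$ (with respect to $d_1=(n-1)^3$, $d_2=n^3$, $d_3=(n+1)^3$), its genus $G$ and its Frobenius number $F$ are as follows. (0) Exceptional cases. For $n=4$: $\mathcal{A}=\begin{pmatrix}7&-1&-1\\-1&18&-9\\-6&-17&10\end{pmatrix}$, $G=558$, $F=1098$. For $n=6$: $\mathcal{A}=\begin{pmatrix}31&-10&-5\\-6&13&-6\\-25&-3&11\end{pmatrix}$, $G=2670$, $F=5249$. (1) $n=18m$, $m\ge 1$: $$\mathcal{A}=\begin{pmatrix}108m^2+55m+1&-(108m^2-16m-15)&-(53m-1)\\-m(108m+1)&108m^2-16m+1&-m\\-(54m+1)&-16&54m-1\end{pmatrix},$$ $G=314928m^5+110808m^4+16632m^3+532m^2-62m$; $F=629856m^5+215784m^4+34020m^3+1890m^2-109m-1$ if $m\le 15$; $F=629856m^5+221616m^4-58320m^3+1944m^2-108m-1$ if $m\ge 16$. (2) $n=18m+2$, $m\ge 1$: $$\mathcal{A}=\begin{pmatrix}108m^2+37m+3&-(108m^2+8m-3)&-(11m+1)\\-(108m^2-17m-4)&108m^2+8m+13&-(43m+4)\\-(54m+7)&-16&54m+5\end{pmatrix},$$ $G=314928m^5+285768m^4+104760m^3+15244m^2+786m+6$; $F=629856m^5+571536m^4+190512m^3+31752m^2+2548m+75$. (3) $n=18m+4$, $m\ge 1$: $$\mathcal{A}=\begin{pmatrix}108m^2+55m+7&-(108m^2+32m+1)&-(5m+1)\\-(108m^2+m-6)&108m^2+32m+17&-(49m+10)\\-(54m+13)&-16&54m+11\end{pmatrix},$$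 $G=314928m^5+460728m^4+270648m^3+77476m^2+10674m+564$; $F=629856m^5+921456m^4+532656m^3+153144m^2+21812m+1223$. (4) $n=18m+6$, $m\ge 1$: $$\mathcal{A}=\begin{pmatrix}108m^2+109m+25&-(108m^2+56m-3)&-(35m+11)\\-(108m^2+55m+6)&108m^2+56m+13&-(19m+6)\\-(54m+19)&-16&54m+17\end{pmatrix},$$ $G=314928m^5+635688m^4+514296m^3+202780m^2+38434m+2778$; $F=629856m^5+1271376m^4+968112m^3+355752m^2+63828m+4499$. (5) $n=18m+8$, $m\ge 0$: $$\mathcal{A}=\begin{pmatrix}108m^2+145m+44&-(108m^2+80m+1)&-(47m+20)\\-(108m^2+91m+19)&108m^2+80m+17&-(7m+3)\\-(54m+25)&-16&54m+23\end{pmatrix},$$ $G=314928m^5+810648m^4+835704m^3+428308m^2+108658m+10888$; $F=629856m^5+1580472m^4+1604772m^3+821178m^2+210979m+21700$ if $m\in\{0,1\}$; $F=629856m^5+1621296m^4+1590192m^3+753624m^2+173908m+15695$ if $m\ge 2$. (6) $n=18m+10$, $m\ge 0$: $$\mathcal{A}=\begin{pmatrix}108m^2+163m+58&-(108m^2+104m+13)&-(41m+22)\\-(108m^2+109m+27)&108m^2+104m+29&-(13m+7)\\-(54m+31)&-16&54m+29\end{pmatrix},$$ $G=314928m^5+985608m^4+1234872m^3+769612m^2+237666m+29022$; $F=55222$ if $m=0$; $F=629856m^5+1971216m^4+2398896m^3+1429704m^2+419252m+48539$ if $m\ge 1$. (7) $n=18m+12$, $m\ge 0$: $$\mathcal{A}=\begin{pmatrix}108m^2+163m+61&-(108m^2+128m+33)&-(17m+11)\\-(108m^2+109m+24)&108m^2+128m+49&-(37m+24)\\-(54m+37)&-16&54m+35\end{pmatrix},$$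 $G=314928m^5+1160568m^4+1711800m^3+1257796m^2+459058m+66444$; $F=629856m^5+2321136m^4+3394224m^3+2466936m^2+892404m+128663$. (8) $n=18m+14$, $m\ge 0$: $$\mathcal{A}=\begin{pmatrix}108m^2+199m+90&-(108m^2+152m+45)&-(29m+22)\\-(108m^2+145m+47)&108m^2+152m+61&-(25m+19)\\-(54m+43)&-16&54m+41\end{pmatrix},$$ $G=314928m^5+1335528m^4+2266488m^3+1917916m^2+807378m+135042$; $F=629856m^5+2671056m^4+4482864m^3+3730536m^2+1541908m+253539$. (9) $n=18m+16$, $m\ge 0$: $$\mathcal{A}=\begin{pmatrix}108m^2+217m+108&-(108m^2+176m+65)&-(23m+20)\\-(108m^2+163m+59)&108m^2+176m+81&-(31m+27)\\-(54m+49)&-16&54m+47\end{pmatrix},$$ $G=314928m^5+1510488m^4+2898936m^3+2776756m^2+1325266m+251824$; $F=629856m^5+3020976m^4+5758128m^3+5458968m^2+2576660m+484767$.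
   Context: For positive integers $d_1,d_2,d_3$ with $\gcd(d_1,d_2,d_3)=1$, $S=\langle d_1,d_2,d_3\rangle=\{x_1d_1+x_2d_2+x_3d_3 : x_i\in\mathbb{Z}_{\ge 0}\}$ is the numerical semigroup they generate. The Frobenius number $F(S)$ is the largest integer not in $S$; the genus $G(S)$ is the number of non-negative integers not in $S$. For a nonsymmetric $S=\langle d_1,d_2,d_3\rangle$, the matrix of minimal relations is the integer matrix $$\mathcal{A}=\begin{pmatrix}a_{11}&-a_{12}&-a_{13}\\-a_{21}&a_{22}&-a_{23}\\-a_{31}&-a_{32}&a_{33}\end{pmatrix},\qquad a_{ij}\in\mathbb{Z}_{\ge 0},$$ such that $\mathcal{A}(d_1,d_2,d_3)^{T}=0$, the greatest common divisor of the entries of each row is $1$, and for each $i$, with $\{i,j,k\}=\{1,2,3\}$, $a_{ii}=\min\{v\ge 2 : v\,d_i=v_jd_j+v_kd_k \text{ for some } v_j,v_k\in\mathbb{Z}_{\ge 0}\}$. (For nonsymmetric $S$ it is unique.) $S$ is symmetric if for every integer $s$ exactly one of $s,F(S)-s$ lies in $S$; the semigroups $R_n^3$ with $n\ge 4$ are nonsymmetric. *)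

theory Defs
  imports "HOL-Analysis.Analysis"
begin

text \<open>
  Generators are collected in a vector \<^term>\<open>d :: int ^ 'n\<close>.  Semigroups are sets of
  integers, because symmetry refers to all integers \<open>s\<close>, including negative ones.
\<close>

definition num_semigroup :: "int ^ 'n \<Rightarrow> int set" where
  "num_semigroup d = {s. \<exists>x :: int ^ 'n. (\<forall>i. 0 \<le> x $ i) \<and> s = (\<Sum>i\<in>UNIV. x $ i * d $ i)}"

definition frobenius :: "int set \<Rightarrow> int" where
  "frobenius S = (GREATEST s. s \<notin> S)"

definition genus :: "int set \<Rightarrow> nat" where
  "genus S = card {s. 0 \<le> s \<and> s \<notin> S}"

definition symmetric_semigroup :: "int set \<Rightarrow> bool" where
  "symmetric_semigroup S \<longleftrightarrow> (\<forall>s. (s \<in> S) \<noteq> (frobenius S - s \<in> S))"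

text \<open>
  The matrix is only defined for nonsymmetric semigroups.  The sign conditions say that
  \<^term>\<open>A\<close> has the entries \<open>a\<^sub>i\<^sub>i\<close> on the diagonal and \<open>- a\<^sub>i\<^sub>j\<close> off the diagonal, with
  all \<open>a\<^sub>i\<^sub>j\<close> nonnegative.
\<close>

definition minimal_relation_matrix :: "int ^ 3 \<Rightarrow> int ^ 3 ^ 3 \<Rightarrow> bool" where
  "minimal_relation_matrix d A \<longleftrightarrow>
     \<not> symmetric_semigroup (num_semigroup d) \<and>
     (\<forall>i j. if i = j then 0 \<le> A $ i $ j else A $ i $ j \<le> 0) \<and>
     A *v d = 0 \<and>
     (\<forall>i. Gcd (range (\<lambda>j. A $ i $ j)) = 1) \<and>
     (\<forall>i j k. {i, j, k} = UNIV \<longrightarrow>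
        A $ i $ i =
          (LEAST v. 2 \<le> v \<and> (\<exists>vj\<ge>0. \<exists>vk\<ge>0. v * d $ i = vj * d $ j + vk * d $ k)))"

definition consecutive_cubes :: "int \<Rightarrow> int ^ 3" where
  "consecutive_cubes n = vector [(n - 1)^3, n^3, (n + 1)^3]"

end

theory Submission
  imports Defs
begin

text \<open>
  Write the relation matrix as positive diagonal, negative off-diagonal entries, zero column sums,
  and suppose that \<open>d\<^sub>1, d\<^sub>2, d\<^sub>3\<close> are the principal \<open>2 \<times> 2\<close> minors and jointly coprime.
  Using the three relations to decrease \<open>x d\<^sub>2 + y d\<^sub>3\<close> by positive multiples of \<open>d\<^sub>1\<close> brings every
  \<open>(x, y)\<close> into an L-shaped region with exactly \<open>d\<^sub>1\<close> lattice points.  By counting, this region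
  represents each residue class modulo \<open>d\<^sub>1\<close> exactly once, so it is the Apery set with respect to
  \<open>d\<^sub>1\<close>.  Its two corners give the Frobenius number (and, being two maximal gaps, nonsymmetry), and
  summing over it gives the genus.  The only descent steps that end in the origin use the first
  row, which makes that row minimal and unique; the other rows follow by cyclic symmetry.  For
  consecutive cubes it remains to check polynomial identities in \<open>m\<close>.
\<close>

section \<open>Preliminaries: three generators, sums over intervals and rectangles\<close>

lemma num_semigroup_3:
  "num_semigroup (vector [a, b, c] :: int ^ 3) =
     {x * a + y * b + z * c | x y z. 0 \<le> x \<and> 0 \<le> y \<and> 0 \<le> z}" (is "?S = ?T")
proof
  show "?S \<subseteq> ?T"
    by (auto simp: num_semigroup_def sum_3 forall_3)
  show "?T \<subseteq> ?S"
  proof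
    fix w assume "w \<in> ?T"
    then obtain x y z where "0 \<le> x" "0 \<le> y" "0 \<le> z" "w = x * a + y * b + z * c"
      by blast
    then show "w \<in> ?S"
      unfolding num_semigroup_def
      by (auto simp: sum_3 forall_3 intro!: exI[of _ "vector [x, y, z] :: int ^ 3"])
  qed
qed

text \<open>Doubling keeps all closed forms, up to the genus formula, free of division.\<close>

lemma double_sum_int_interval:
  fixes a b :: int
  assumes "a \<le> b"
  shows "2 * \<Sum>{a..<b} = (b - a) * (a + b - 1)"
  using assms
proof (induction b rule: int_ge_induct)
  case (step i)
  then have "{a..<i + 1} = insert i {a..<i}" by auto
  with step show ?case by (simp add: algebra_simps)
qed simp

lemma double_sum_rectangle:
  fixes a b c d e f :: int
  assumes "a \<le> b" "c \<le> d"
  shows "2 * (\<Sum>(x, y)\<in>{a..<b} \<times> {c..<d}. x * e + y * f) =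
    (b - a) * (d - c) * ((a + b - 1) * e + (c + d - 1) * f)"
proof -
  have "(\<Sum>(x, y)\<in>{a..<b} \<times> {c..<d}. x * e + y * f) =
      (d - c) * (\<Sum>{a..<b} * e) + (b - a) * (\<Sum>{c..<d} * f)"
    using assms
    by (simp add: sum.cartesian_product[symmetric] sum.distrib sum_distrib_right sum_distrib_left)
  then have "2 * (\<Sum>(x, y)\<in>{a..<b} \<times> {c..<d}. x * e + y * f) =
      (d - c) * (2 * \<Sum>{a..<b} * e) + (b - a) * (2 * \<Sum>{c..<d} * f)"
    by (simp add: algebra_simps)
  also have "\<dots> = (b - a) * (d - c) * ((a + b - 1) * e + (c + d - 1) * f)"
    unfolding double_sum_int_interval[OF assms(1)] double_sum_int_interval[OF assms(2)]
    by (simp add: algebra_simps)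
  finally show ?thesis .
qed

section \<open>Relation matrices with vanishing column sums\<close>

text \<open>
  In terms of the relation matrix, \<open>p = a\<^sub>2\<^sub>1\<close>, \<open>q = a\<^sub>3\<^sub>1\<close>, \<open>r = a\<^sub>1\<^sub>2\<close>, \<open>s = a\<^sub>3\<^sub>2\<close>, \<open>t = a\<^sub>1\<^sub>3\<close>,
  \<open>u = a\<^sub>2\<^sub>3\<close>, and the diagonal is \<open>p + q\<close>, \<open>r + s\<close>, \<open>t + u\<close>.
\<close>

locale relation_matrix =
  fixes d1 d2 d3 p q r s t u :: int
  assumes pos: "0 < p" "0 < q" "0 < r" "0 < s" "0 < t" "0 < u"
    and d1: "d1 = r * t + r * u + s * t"
    and d2: "d2 = p * t + p * u + q * u"
    and d3: "d3 = p * s + q * r + q * s"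
    and gcd1: "gcd d1 (gcd d2 d3) = 1"
begin

text \<open>Shifting the indices 1, 2, 3 cyclically permutes rows and columns alike and keeps all
  assumptions; facts proved for row 1 thereby become available for rows 2 and 3.\<close>

lemma rotate: "relation_matrix d2 d3 d1 s r u t p q"
proof
  show "gcd d2 (gcd d3 d1) = 1"
    using gcd1 by (simp add: ac_simps)
qed (use pos in \<open>auto simp: d1 d2 d3 algebra_simps\<close>)

lemma d_pos: "0 < d1" "0 < d2" "0 < d3"
  using pos by (auto simp: d1 d2 d3 add_pos_pos)

text \<open>Since the columns sum to zero, every column of the adjugate is the vector of principal
  minors \<open>(d1, d2, d3)\<close>, and the matrix has determinant zero, so it annihilates that
  vector.\<close>

lemma row1: "(p + q) * d1 = r * d2 + t * d3"
  and row2: "(r + s) * d2 = p * d1 + u * d3"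
  and row3: "(t + u) * d3 = q * d1 + s * d2"
  by (simp_all add: d1 d2 d3 algebra_simps)

section \<open>The L-shaped region as Apery set of the semigroup with respect to
  \<open>d1\<close>\<close>

abbreviation S :: "int set" where
  "S \<equiv> num_semigroup (vector [d1, d2, d3] :: int ^ 3)"

text \<open>The three parts of the quadrant left out are those where a relation can trade for copies
  of \<open>d1\<close>: row 2 when \<open>r + s \<le> x\<close>, row 3 when
  \<open>t + u \<le> y\<close>, row 1 when \<open>r \<le> x\<close> and
  \<open>t \<le> y\<close>.\<close>

definition L :: "(int \<times> int) set" where
  "L = {0..<r + s} \<times> {0..<t + u} - {r..<r + s} \<times> {t..<t + u}"

abbreviation w :: "int \<times> int \<Rightarrow> int" where
  "w \<equiv> \<lambda>(x, y). x * d2 + y * d3"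

lemma finite_L: "finite L"
  by (simp add: L_def)

text \<open>The rectangle minus its removed block has \<open>(r + s) * (t + u) - s * u\<close>
  points, which is the minor of rows and columns 2 and 3. This count later yields uniqueness of
  representations.\<close>

lemma card_L: "int (card L) = d1"
proof -
  have "card L = nat (r + s) * nat (t + u) - nat s * nat u"
    unfolding L_def using pos by (subst card_Diff_subset) (auto simp: card_cartesian_product)
  also have "\<dots> = nat ((r + s) * (t + u) - s * u)"
    using pos by (simp add: nat_mult_distrib nat_diff_distrib')
  also have "(r + s) * (t + u) - s * u = d1"
    by (simp add: d1 algebra_simps)
  finally show ?thesis
    using d_pos by simp
qed

lemma w_nonneg: "0 \<le> x \<Longrightarrow> 0 \<le> y \<Longrightarrow> 0 \<le> x * d2 + y * d3"
  using d_pos by simp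

lemma w_pos: "0 \<le> x \<Longrightarrow> 0 \<le> y \<Longrightarrow> (x, y) \<noteq> (0, 0) \<Longrightarrow> 0 < x * d2 + y * d3"
  using d_pos by (auto simp: order_le_less add_pos_pos)

lemma step_cases:
  assumes "0 \<le> x" "0 \<le> y" "(x, y) \<notin> L"
  obtains (x) "r + s \<le> x" "x * d2 + y * d3 = p * d1 + ((x - (r + s)) * d2 + (y + u) * d3)"
    | (y) "t + u \<le> y" "x * d2 + y * d3 = q * d1 + ((x + s) * d2 + (y - (t + u)) * d3)"
    | (xy) "r \<le> x" "t \<le> y" "x * d2 + y * d3 = (p + q) * d1 + ((x - r) * d2 + (y - t) * d3)"
proof -
  consider "r + s \<le> x" | "t + u \<le> y" | "r \<le> x" "t \<le> y"
    using assms unfolding L_def by auto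
  then show thesis
  proof cases
    case 1
    then show ?thesis using x row2 by (simp add: algebra_simps)
  next
    case 2
    then show ?thesis using y row3 by (simp add: algebra_simps)
  next
    case 3
    then show ?thesis using xy row1 by (simp add: algebra_simps)
  qed
qed

text \<open>Each exchange from \<open>step_cases\<close> keeps both coefficients nonnegative and
  lowers the nonnegative value \<open>x * d2 + y * d3\<close> by a positive multiple of
  \<open>d1\<close>, so the descent ends inside \<open>L\<close>.\<close>

lemma reduce:
  assumes "0 \<le> x" "0 \<le> y"
  shows "\<exists>k\<ge>0. \<exists>v\<in>L. x * d2 + y * d3 = k * d1 + w v"
  using assms
proof (induction "nat (x * d2 + y * d3)" arbitrary: x y rule: less_induct)
  case less
  have descend: ?case
    if "0 < a" "0 \<le> x'" "0 \<le> y'" "x * d2 + y * d3 = a * d1 + (x' * d2 + y' * d3)" for a x' y'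
  proof -
    have "0 < a * d1" using that d_pos by simp
    then have "nat (x' * d2 + y' * d3) < nat (x * d2 + y * d3)"
      using that w_nonneg[of x' y'] by linarith
    from less(1)[OF this] that obtain k v
      where "0 \<le> k" "v \<in> L" "x' * d2 + y' * d3 = k * d1 + w v" by blast
    with that show ?thesis
      by (intro exI[of _ "a + k"] conjI bexI[of _ v]) (auto simp: algebra_simps)
  qed
  show ?case
  proof (cases "(x, y) \<in> L")
    case True
    then show ?thesis by (intro exI[of _ 0] conjI bexI[of _ "(x, y)"]) auto
  next
    case False
    show ?thesis
      by (rule step_cases[OF less(2,3) False]; rule descend)
        (use less(2,3) pos in auto)
  qed
qed

lemma exists_representation: "\<exists>k. \<exists>v\<in>L. z = k * d1 + w v"
proof -
  obtain a b where ab: "a * d1 + b * gcd d2 d3 = 1"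
    using bezout_int[of d1 "gcd d2 d3"] gcd1 by metis
  obtain e f where ef: "e * d2 + f * d3 = gcd d2 d3"
    using bezout_int by metis
  \<comment> \<open>\<open>reduce\<close> needs nonnegative coefficients, so the Bezout coefficients
    are replaced by their residues modulo \<open>d1\<close>; the quotients move into the multiple of
    \<open>d1\<close>.\<close>
  define x X where "x = (z * b * e) mod d1" and "X = (z * b * e) div d1"
  define y Y where "y = (z * b * f) mod d1" and "Y = (z * b * f) div d1"
  have x: "z * b * e = X * d1 + x" and y: "z * b * f = Y * d1 + y"
    by (simp_all add: x_def y_def X_def Y_def)
  have "z = z * (a * d1 + b * (e * d2 + f * d3))"
    using ab ef by simp
  also have "\<dots> = z * a * d1 + (z * b * e) * d2 + (z * b * f) * d3"
    by (simp add: algebra_simps)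
  also have "\<dots> = (z * a + X * d2 + Y * d3) * d1 + (x * d2 + y * d3)"
    unfolding x y by (simp add: algebra_simps)
  finally have "z = (z * a + X * d2 + Y * d3) * d1 + (x * d2 + y * d3)" .
  moreover obtain k v where "v \<in> L" "x * d2 + y * d3 = k * d1 + w v"
    using reduce[of x y] d_pos by (auto simp: x_def y_def)
  ultimately show ?thesis
    by (intro exI[of _ "z * a + X * d2 + Y * d3 + k"] bexI[of _ v]) (simp_all add: distrib_right)
qed

text \<open>Surjectivity is \<open>exists_representation\<close>; as \<open>L\<close> has exactly
  \<open>d1\<close> points, injectivity follows by counting.\<close>

lemma bij_betw_residues: "bij_betw (\<lambda>v. w v mod d1) L {0..<d1}"
proof -
  have image: "(\<lambda>v. w v mod d1) ` L = {0..<d1}"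
  proof
    show "(\<lambda>v. w v mod d1) ` L \<subseteq> {0..<d1}"
      using d_pos by auto
    show "{0..<d1} \<subseteq> (\<lambda>v. w v mod d1) ` L"
    proof
      fix z assume z: "z \<in> {0..<d1}"
      obtain k v where "v \<in> L" "z = k * d1 + w v"
        using exists_representation by blast
      moreover from this have "z mod d1 = w v mod d1" by simp
      then have "z = w v mod d1" using z by simp
      ultimately show "z \<in> (\<lambda>v. w v mod d1) ` L" by blast
    qed
  qed
  moreover have "inj_on (\<lambda>v. w v mod d1) L"
    using card_L image by (intro eq_card_imp_inj_on) (auto simp: finite_L)
  ultimately show ?thesis
    by (simp add: bij_betw_def)
qed

lemma representation_unique:
  assumes "v \<in> L" "v' \<in> L" "k * d1 + w v = k' * d1 + w v'"
  shows "v = v'" and "k = k'"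
proof -
  have "(k * d1 + w v) mod d1 = (k' * d1 + w v') mod d1"
    using assms(3) by simp
  then have "w v mod d1 = w v' mod d1"
    by simp
  then show v: "v = v'"
    using assms(1,2) bij_betw_residues by (auto simp: bij_betw_def inj_on_def)
  show "k = k'"
    using assms(3) d_pos unfolding v by simp
qed

text \<open>Reducing the \<open>d2\<close>, \<open>d3\<close> part of an element of \<open>S\<close>
  only adds copies of \<open>d1\<close>, and the outcome is the unique representation over
  \<open>L\<close>. Thus \<open>w v\<close> is the least element of \<open>S\<close> in its residue
  class modulo \<open>d1\<close>.\<close>

lemma mem_S_iff:
  assumes "v \<in> L"
  shows "k * d1 + w v \<in> S \<longleftrightarrow> 0 \<le> k"
proof
  assume "k * d1 + w v \<in> S"
  then obtain a x y where axy: "0 \<le> a" "0 \<le> x" "0 \<le> y" "k * d1 + w v = a * d1 + x * d2 + y * d3"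
    unfolding num_semigroup_3 by blast
  obtain k' v' where "0 \<le> k'" "v' \<in> L" "x * d2 + y * d3 = k' * d1 + w v'"
    using reduce axy by blast
  with axy have "k * d1 + w v = (a + k') * d1 + w v'"
    by (simp add: algebra_simps)
  with assms \<open>v' \<in> L\<close> have "k = a + k'"
    by (rule representation_unique)
  with axy \<open>0 \<le> k'\<close> show "0 \<le> k" by simp
next
  assume "0 \<le> k"
  moreover have "0 \<le> fst v" "0 \<le> snd v" "w v = fst v * d2 + snd v * d3"
    using assms by (auto simp: L_def)
  ultimately show "k * d1 + w v \<in> S"
    unfolding num_semigroup_3 mem_Collect_eq by (metis add.assoc)
qed

section \<open>Frobenius number and nonsymmetry\<close>

lemma w_minus_d1_notin_S: "v \<in> L \<Longrightarrow> w v - d1 \<notin> S"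
  using mem_S_iff[of v "-1"] by simp

text \<open>\<open>L\<close> is the union of two boxes at the origin whose far corners are these two
  points, and \<open>w\<close> is monotone in both coordinates.\<close>

lemma w_L_le:
  assumes "v \<in> L"
  shows "w v \<le> max (w (r + s - 1, t - 1)) (w (r - 1, t + u - 1))"
proof -
  obtain x y where v: "v = (x, y)" by fastforce
  have "x \<le> r + s - 1 \<and> y \<le> t - 1 \<or> x \<le> r - 1 \<and> y \<le> t + u - 1"
    using assms by (auto simp: v L_def)
  moreover have "x * d2 + y * d3 \<le> x' * d2 + y' * d3" if "x \<le> x'" "y \<le> y'" for x' y'
    using that d_pos by (simp add: add_mono mult_right_mono)
  ultimately show ?thesis
    unfolding v by (fastforce simp: le_max_iff_disj)
qed

lemma corners_in_L: "(r + s - 1, t - 1) \<in> L" "(r - 1, t + u - 1) \<in> L"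
  using pos by (auto simp: L_def)

text \<open>The largest gap in each residue class is its Apery element minus \<open>d1\<close>, so
  the largest gap overall comes from the largest Apery element.\<close>

lemma frobenius_eq_max:
  "frobenius S = max (w (r + s - 1, t - 1)) (w (r - 1, t + u - 1)) - d1"
  unfolding frobenius_def
proof (rule Greatest_equality)
  have "max (w (r + s - 1, t - 1)) (w (r - 1, t + u - 1)) \<in> w ` L"
    using corners_in_L by (simp only: max_def split: if_splits) blast
  then obtain v where v: "v \<in> L" "max (w (r + s - 1, t - 1)) (w (r - 1, t + u - 1)) = w v"
    by blast
  show "max (w (r + s - 1, t - 1)) (w (r - 1, t + u - 1)) - d1 \<notin> S"
    unfolding v(2) using v(1) by (rule w_minus_d1_notin_S)
next
  fix z assume "z \<notin> S"
  obtain k v where v: "v \<in> L" "z = k * d1 + w v"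
    using exists_representation by blast
  with \<open>z \<notin> S\<close> have "k \<le> -1"
    using mem_S_iff by fastforce
  then have "k * d1 \<le> -1 * d1"
    using d_pos by (intro mult_right_mono) auto
  then show "z \<le> max (w (r + s - 1, t - 1)) (w (r - 1, t + u - 1)) - d1"
    using v w_L_le[OF v(1)] by linarith
qed

text \<open>The two corners give gaps \<open>f\<close> and \<open>g\<close>, one of which is the
  Frobenius number. Symmetry applied to the other would put \<open>f - g\<close> or
  \<open>g - f\<close> into \<open>S\<close>, yet both are gaps.\<close>

lemma not_symmetric: "\<not> symmetric_semigroup S"
proof
  assume "symmetric_semigroup S"
  then have sym: "(z \<in> S) \<noteq> (frobenius S - z \<in> S)" for z
    unfolding symmetric_semigroup_def by (rule spec)
  define f g where "f = w (r + s - 1, t - 1) - d1" and "g = w (r - 1, t + u - 1) - d1"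
  have "f \<notin> S" "g \<notin> S"
    unfolding f_def g_def by (intro w_minus_d1_notin_S corners_in_L)+
  \<comment> \<open>Row 3 rewrites \<open>s * d2 - u * d3\<close> as \<open>t * d3 - q * d1\<close>,
    and row 2 rewrites its negative as \<open>r * d2 - p * d1\<close>: points of \<open>L\<close>
    with a negative coefficient of \<open>d1\<close>, hence gaps.\<close>
  moreover have "f - g = - q * d1 + w (0, t)" "g - f = - p * d1 + w (r, 0)"
    using row2 row3 by (simp_all add: f_def g_def algebra_simps)
  moreover have "(0, t) \<in> L" "(r, 0) \<in> L"
    using pos by (auto simp: L_def)
  then have "- q * d1 + w (0, t) \<notin> S" "- p * d1 + w (r, 0) \<notin> S"
    using mem_S_iff[of "(0, t)" "-q"] mem_S_iff[of "(r, 0)" "-p"] pos by simp_all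
  ultimately have "f - g \<notin> S" "g - f \<notin> S"
    by simp_all
  moreover have "frobenius S = f \<or> frobenius S = g"
    unfolding frobenius_eq_max f_def g_def max_def by presburger
  ultimately show False
    using sym[of f] sym[of g] \<open>f \<notin> S\<close> \<open>g \<notin> S\<close> by metis
qed

section \<open>The genus\<close>

lemma double_sum_w_L:
  "2 * sum w L = (r + s) * (t + u) * ((r + s - 1) * d2 + (t + u - 1) * d3)
     - s * u * ((2 * r + s - 1) * d2 + (2 * t + u - 1) * d3)"
proof -
  have "sum w L = sum w ({0..<r + s} \<times> {0..<t + u}) - sum w ({r..<r + s} \<times> {t..<t + u})"
    unfolding L_def using pos by (intro sum_diff) auto
  then show ?thesis
    using double_sum_rectangle[of 0 "r + s" 0 "t + u" d2 d3] pos
      double_sum_rectangle[of r "r + s" t "t + u" d2 d3]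
    by (simp add: algebra_simps)
qed

text \<open>In the residue class of \<open>w v\<close> the nonnegative gaps are
  \<open>w v - j * d1\<close> with \<open>1 \<le> j \<le> w v div d1\<close>; the map
  \<open>f\<close> enumerates them over all classes.\<close>

lemma genus_eq_sum: "int (genus S) = (\<Sum>v\<in>L. w v div d1)"
proof -
  have w_nonneg_L: "0 \<le> w v" if "v \<in> L" for v
    using that w_nonneg by (auto simp: L_def)
  have le_div_iff: "j \<le> z div d1 \<longleftrightarrow> j * d1 \<le> z" for j z
  proof
    assume "j \<le> z div d1"
    then have "j * d1 \<le> z div d1 * d1"
      using d_pos by (intro mult_right_mono) auto
    also have "\<dots> \<le> z"
      using d_pos pos_mod_sign[of d1 z] div_mult_mod_eq[of z d1] by linarith
    finally show "j * d1 \<le> z" .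
  next
    assume "j * d1 \<le> z"
    then show "j \<le> z div d1"
      using zdiv_mono1[of "j * d1" z d1] d_pos by simp
  qed
  define f where "f = (\<lambda>(v, j). - j * d1 + w v)"
  have "bij_betw f (SIGMA v:L. {1..w v div d1}) {z. 0 \<le> z \<and> z \<notin> S}"
    unfolding bij_betw_def
  proof
    show "inj_on f (SIGMA v:L. {1..w v div d1})"
    proof (rule inj_onI)
      fix a b assume ab: "a \<in> (SIGMA v:L. {1..w v div d1})" "b \<in> (SIGMA v:L. {1..w v div d1})" "f a = f b"
      have "f a = - snd a * d1 + w (fst a)" "f b = - snd b * d1 + w (fst b)"
        by (simp_all add: f_def split_beta)
      with ab(3) have "- snd a * d1 + w (fst a) = - snd b * d1 + w (fst b)"
        by (simp only:)
      moreover have "fst a \<in> L" "fst b \<in> L"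
        using ab(1,2) by (simp_all only: mem_Times_iff Sigma_def) auto
      ultimately have "fst a = fst b" "- snd a = - snd b"
        using representation_unique by blast+
      then show "a = b" by (simp add: prod_eq_iff)
    qed
    show "f ` (SIGMA v:L. {1..w v div d1}) = {z. 0 \<le> z \<and> z \<notin> S}"
    proof (intro equalityI subsetI)
      fix z assume "z \<in> f ` (SIGMA v:L. {1..w v div d1})"
      then obtain v j where v: "v \<in> L" "1 \<le> j" "j \<le> w v div d1" "z = - j * d1 + w v"
        by (auto simp: f_def)
      then have "j * d1 \<le> w v"
        unfolding le_div_iff by simp
      then show "z \<in> {z. 0 \<le> z \<and> z \<notin> S}"
        using v mem_S_iff[OF v(1), of "-j"] by simp
    next
      fix z assume "z \<in> {z. 0 \<le> z \<and> z \<notin> S}"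
      then have z: "0 \<le> z" "z \<notin> S" by auto
      obtain k v where v: "v \<in> L" "z = k * d1 + w v"
        using exists_representation by blast
      then have "1 \<le> - k"
        using z mem_S_iff[OF v(1), of k] by auto
      moreover have "- k \<le> w v div d1"
        using z v unfolding le_div_iff by simp
      ultimately show "z \<in> f ` (SIGMA v:L. {1..w v div d1})"
        using v by (auto simp: f_def intro!: image_eqI[of _ _ "(v, - k)"])
    qed
  qed
  then have "genus S = card (SIGMA v:L. {1..w v div d1})"
    unfolding genus_def by (simp add: bij_betw_same_card)
  also have "int \<dots> = (\<Sum>v\<in>L. int (nat (w v div d1)))"
    by (simp add: finite_L)
  also have "\<dots> = (\<Sum>v\<in>L. w v div d1)"
    using d_pos w_nonneg_L by (intro sum.cong refl) (simp add: pos_imp_zdiv_nonneg_iff)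
  finally show ?thesis .
qed

text \<open>Splitting \<open>w v\<close> into quotient and remainder, the remainders run once
  through \<open>{0..<d1}\<close>, so the sum of quotients is known from the sum of \<open>w\<close>
  over \<open>L\<close>.\<close>

lemma double_genus:
  "2 * int (genus S) =
     1 + (p + q - 1) * d1 + (r + s - 1) * d2 + (t + u - 1) * d3 - (p + q) * (r + s) * (t + u)"
proof -
  have "2 * sum w L = 2 * (\<Sum>v\<in>L. d1 * (w v div d1) + w v mod d1)"
    by simp
  also have "\<dots> = d1 * (2 * int (genus S)) + 2 * (\<Sum>v\<in>L. w v mod d1)"
    by (simp only: sum.distrib sum_distrib_left[symmetric] genus_eq_sum) (simp add: algebra_simps)
  also have "(\<Sum>v\<in>L. w v mod d1) = \<Sum>{0..<d1}"
    using bij_betw_residues by (rule sum.reindex_bij_betw)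
  finally have "d1 * (2 * int (genus S)) = 2 * sum w L - d1 * (d1 - 1)"
    using double_sum_int_interval[of 0 d1] d_pos by simp
  \<comment> \<open>Once the minors are substituted, the right-hand side is a multiple of
    \<open>d1\<close>, which then cancels.\<close>
  also have "\<dots> = d1 * (1 + (p + q - 1) * d1 + (r + s - 1) * d2 + (t + u - 1) * d3
      - (p + q) * (r + s) * (t + u))"
    unfolding double_sum_w_L by (simp add: d1 d2 d3 algebra_simps)
  finally show ?thesis
    using d_pos by simp
qed

section \<open>Minimality, uniqueness and primitivity of the relations\<close>

text \<open>\<open>(x, y)\<close> lies outside \<open>L\<close>, since otherwise it and the origin
  would give two representations of \<open>v * d1\<close>. Exchanges by row 2 or 3 leave a nonzero
  pair and hence a smaller positive \<open>v\<close>, where induction applies; an exchange by row 1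
  already removes \<open>(p + q) * d1\<close>.\<close>

lemma row1_minimal:
  assumes "0 \<le> x" "0 \<le> y" "1 \<le> v" "v * d1 = x * d2 + y * d3"
  shows "p + q \<le> v"
  using assms
proof (induction "nat v" arbitrary: v x y rule: less_induct)
  case less
  have descend: "p + q \<le> v"
    if "0 < a" "0 \<le> x'" "0 \<le> y'" "(x', y') \<noteq> (0, 0)"
      "x * d2 + y * d3 = a * d1 + (x' * d2 + y' * d3)" for a x' y'
  proof -
    have va: "(v - a) * d1 = x' * d2 + y' * d3"
      using that less(5) by (simp add: algebra_simps)
    then have "0 < (v - a) * d1"
      using w_pos[of x' y'] that by simp
    then have "1 \<le> v - a"
      using d_pos by (simp add: zero_less_mult_iff)
    then have "p + q \<le> v - a"
      using less(1)[of "v - a" x' y'] that va by auto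
    with that show ?thesis by simp
  qed
  have "(x, y) \<notin> L"
  proof
    assume "(x, y) \<in> L"
    moreover have "(0, 0) \<in> L" using pos by (simp add: L_def)
    moreover have "0 * d1 + w (x, y) = v * d1 + w (0, 0)" using less(5) by simp
    ultimately have "0 = v" by (rule representation_unique)
    with less show False by simp
  qed
  with less(2,3) show ?case
  proof (cases rule: step_cases)
    case x
    then show ?thesis using descend[of p "x - (r + s)" "y + u"] pos less(2,3) by auto
  next
    case y
    then show ?thesis using descend[of q "x + s" "y - (t + u)"] pos less(2,3) by auto
  next
    case xy
    then have "(p + q) * d1 \<le> v * d1"
      using w_nonneg[of "x - r" "y - t"] less(5) by simp
    then show ?thesis using d_pos by simp
  qed
qed

text \<open>An exchange by row 2 or 3 would leave a representation of \<open>q * d1\<close> or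
  \<open>p * d1\<close>, against minimality. So row 1 applies, and it leaves value zero, which only
  the origin has.\<close>

lemma row1_unique:
  assumes "0 \<le> x" "0 \<le> y" "(p + q) * d1 = x * d2 + y * d3"
  shows "x = r \<and> y = t"
proof -
  have "(x, y) \<notin> L"
  proof
    assume "(x, y) \<in> L"
    moreover have "(0, 0) \<in> L" using pos by (simp add: L_def)
    moreover have "0 * d1 + w (x, y) = (p + q) * d1 + w (0, 0)" using assms by simp
    ultimately have "0 = p + q" by (rule representation_unique)
    with pos show False by simp
  qed
  with assms(1,2) show ?thesis
  proof (cases rule: step_cases)
    case x
    then have "q * d1 = (x - (r + s)) * d2 + (y + u) * d3"
      using assms(3) by (simp add: algebra_simps)
    then have "p + q \<le> q"
      using row1_minimal[of "x - (r + s)" "y + u" q] x assms pos by simp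
    with pos show ?thesis by simp
  next
    case y
    then have "p * d1 = (x + s) * d2 + (y - (t + u)) * d3"
      using assms(3) by (simp add: algebra_simps)
    then have "p + q \<le> p"
      using row1_minimal[of "x + s" "y - (t + u)" p] y assms pos by simp
    with pos show ?thesis by simp
  next
    case xy
    then have "(x - r) * d2 + (y - t) * d3 = 0" using assms(3) by simp
    then show ?thesis using w_pos[of "x - r" "y - t"] xy by fastforce
  qed
qed

lemma row1_Least:
  "(LEAST v. 2 \<le> v \<and> (\<exists>x\<ge>0. \<exists>y\<ge>0. v * d1 = x * d2 + y * d3)) = p + q"
proof (rule Least_equality)
  have "\<exists>x\<ge>0. \<exists>y\<ge>0. (p + q) * d1 = x * d2 + y * d3"
    using row1 pos by (intro exI[of _ r] exI[of _ t] conjI) auto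
  then show "2 \<le> p + q \<and> (\<exists>x\<ge>0. \<exists>y\<ge>0. (p + q) * d1 = x * d2 + y * d3)"
    using pos by simp
next
  fix v assume "2 \<le> v \<and> (\<exists>x\<ge>0. \<exists>y\<ge>0. v * d1 = x * d2 + y * d3)"
  then show "p + q \<le> v" using row1_minimal by auto
qed

text \<open>\<open>minimal_relation_matrix\<close> quantifies over both orders of the two remaining
  indices.\<close>

lemma row1_Least_swap:
  "(LEAST v. 2 \<le> v \<and> (\<exists>x\<ge>0. \<exists>y\<ge>0. v * d1 = x * d3 + y * d2)) = p + q"
proof -
  have "(\<exists>x\<ge>0. \<exists>y\<ge>0. v * d1 = x * d3 + y * d2) \<longleftrightarrow> (\<exists>x\<ge>0. \<exists>y\<ge>0. v * d1 = x * d2 + y * d3)" for v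
    by (metis add.commute)
  then show ?thesis using row1_Least by simp
qed

text \<open>Each of \<open>d1\<close>, \<open>d2\<close>, \<open>d3\<close> can be written so that
  every term contains an entry of row 1; a common divisor of the row thus divides their gcd.\<close>

lemma row1_coprime: "gcd (p + q) (gcd r t) = 1"
proof -
  let ?g = "gcd (p + q) (gcd r t)"
  have g: "?g dvd p + q" "?g dvd r" "?g dvd t"
    by (auto intro: dvd_trans gcd_dvd2)
  have "d2 = (p + q) * (t + u) - t * q" "d3 = (p + q) * (r + s) - r * p"
    by (simp_all add: d2 d3 algebra_simps)
  then have "?g dvd d1" "?g dvd d2" "?g dvd d3"
    using g by (simp_all add: d1)
  then have "?g dvd gcd d1 (gcd d2 d3)"
    by (intro gcd_greatest)
  then show ?thesis
    by (simp add: gcd1)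
qed

end

section \<open>Identification of the matrix of minimal relations\<close>

lemma set_eq_UNIV_3:
  "{i, j, k} = (UNIV :: 3 set) \<longleftrightarrow>
     (i, j, k) \<in> {(1, 2, 3), (1, 3, 2), (2, 1, 3), (2, 3, 1), (3, 1, 2), (3, 2, 1)}"
proof -
  have "{i, j, k} = (UNIV :: 3 set) \<longleftrightarrow> (\<forall>x. x = i \<or> x = j \<or> x = k)"
    by auto
  then show ?thesis
    unfolding forall_3 using exhaust_3[of i] exhaust_3[of j] exhaust_3[of k]
    by (elim disjE) simp_all
qed

lemma Gcd_range_3: "Gcd (range (\<lambda>j::3. (f j :: int))) = gcd (f 1) (gcd (f 2) (f 3))"
  by (simp add: UNIV_3)

context relation_matrix
begin

text \<open>The least-value condition fixes the diagonal; each kernel equation then represents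
  \<open>a\<^sub>i\<^sub>i * d\<^sub>i\<close> by the other two generators, and that representation
  is unique.\<close>

lemma minimal_relation_matrix_iff:
  "minimal_relation_matrix (vector [d1, d2, d3]) A \<longleftrightarrow>
     A = vector [vector [p + q, - r, - t], vector [- p, r + s, - u], vector [- q, - s, t + u]]"
    (is "?M A \<longleftrightarrow> A = ?A")
proof
  interpret rot: relation_matrix d2 d3 d1 s r u t p q
    by (rule rotate)
  interpret rot2: relation_matrix d3 d1 d2 t u q p s r
    by (rule rot.rotate)
  let ?d = "vector [d1, d2, d3] :: int ^ 3"
  \<comment> \<open>The condition over all index permutations collapses to three diagonal values,
    evaluated by the \<open>row1_Least\<close> lemmas of the three rotations.\<close>
  have unfold: "?M B \<longleftrightarrow>
      (\<forall>i j. if i = j then 0 \<le> B $ i $ j else B $ i $ j \<le> 0) \<and>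
      B *v ?d = 0 \<and> (\<forall>i. Gcd (range (\<lambda>j. B $ i $ j)) = 1) \<and>
      B $ 1 $ 1 = p + q \<and> B $ 2 $ 2 = r + s \<and> B $ 3 $ 3 = t + u" for B
    unfolding minimal_relation_matrix_def set_eq_UNIV_3
    using not_symmetric row1_Least row1_Least_swap rot.row1_Least rot.row1_Least_swap
      rot2.row1_Least rot2.row1_Least_swap
    by (auto simp: forall_3 add.commute)
  {
    assume "?M A"
    then have diag: "A $ 1 $ 1 = p + q" "A $ 2 $ 2 = r + s" "A $ 3 $ 3 = t + u"
      and sign: "\<And>i j. i \<noteq> j \<Longrightarrow> A $ i $ j \<le> 0" and ker: "A *v ?d = 0"
      unfolding unfold by metis+
    have "A $ i $ 1 * d1 + A $ i $ 2 * d2 + A $ i $ 3 * d3 = 0" for i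
      using arg_cong[OF ker, of "\<lambda>v. v $ i"] by (simp add: matrix_vector_mult_def sum_3)
    note ker = this[of 1] this[of 2] this[of 3]
    have "- A $ 1 $ 2 = r \<and> - A $ 1 $ 3 = t"
      using sign[of 1 2] sign[of 1 3] ker(1) by (intro row1_unique) (auto simp: diag algebra_simps)
    moreover have "- A $ 2 $ 3 = u \<and> - A $ 2 $ 1 = p"
      using sign[of 2 3] sign[of 2 1] ker(2) by (intro rot.row1_unique) (auto simp: diag algebra_simps)
    moreover have "- A $ 3 $ 1 = q \<and> - A $ 3 $ 2 = s"
      using sign[of 3 1] sign[of 3 2] ker(3) by (intro rot2.row1_unique) (auto simp: diag algebra_simps)
    ultimately show "A = ?A"
      by (auto simp: vec_eq_iff forall_3 diag)
  }
  {
    assume "A = ?A"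
    moreover have "?M ?A"
      unfolding unfold Gcd_range_3
      using pos row1 row2 row3 row1_coprime rot.row1_coprime rot2.row1_coprime
      by (auto simp: forall_3 vec_eq_iff matrix_vector_mult_def sum_3 ac_simps)
    ultimately show "?M A" by simp
  }
qed

text \<open>The two corner values differ by \<open>s * d2 - u * d3\<close>, whose sign decides the
  maximum.\<close>

lemma frobenius_eq_if_le:
  assumes "s * d2 \<le> u * d3"
  shows "frobenius S = r * d2 + (t + u) * d3 - d1 - d2 - d3"
  using assms by (simp add: frobenius_eq_max max_def algebra_simps)

lemma frobenius_eq_if_ge:
  assumes "u * d3 \<le> s * d2"
  shows "frobenius S = (r + s) * d2 + t * d3 - d1 - d2 - d3"
  using assms by (simp add: frobenius_eq_max max_def algebra_simps)

end

section \<open>Specialisation to consecutive cubes\<close>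

text \<open>The entries carry their signs, so that an instance lists the matrix exactly as the
  theorem displays it.\<close>

locale cube_relations =
  fixes n a11 a12 a13 a21 a22 a23 a31 a32 a33 :: int
  assumes off_diagonal: "a12 < 0" "a13 < 0" "a21 < 0" "a23 < 0" "a31 < 0" "a32 < 0"
    and column_sums: "a11 + a21 + a31 = 0" "a12 + a22 + a32 = 0" "a13 + a23 + a33 = 0"
    and minors: "(n - 1)^3 = a22 * a33 - a23 * a32" "n^3 = a11 * a33 - a13 * a31"
      "(n + 1)^3 = a11 * a22 - a12 * a21"
begin

lemma diagonal: "a11 = - a21 - a31" "a22 = - a12 - a32" "a33 = - a13 - a23"
  using column_sums by simp_all

sublocale rel: relation_matrix "(n - 1)^3" "n^3" "(n + 1)^3" "- a21" "- a31" "- a12" "- a32" "- a13" "- a23"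
proof
  \<comment> \<open>The bases \<open>n - 1\<close> and \<open>n\<close> are consecutive integers,
    hence coprime.\<close>
  have "coprime ((n - 1)^3) (n^3)"
    using coprime_diff_one_left[of n] by simp
  then show "gcd ((n - 1)^3) (gcd (n^3) ((n + 1)^3)) = 1"
    by (simp add: gcd.assoc[symmetric])
qed (use off_diagonal in simp_all, (unfold minors diagonal, simp_all add: algebra_simps))

lemma minimal_relation_matrix_iff:
  "\<forall>A. minimal_relation_matrix (consecutive_cubes n) A \<longleftrightarrow>
     A = vector [vector [a11, a12, a13], vector [a21, a22, a23], vector [a31, a32, a33]]"
  using rel.minimal_relation_matrix_iff by (simp add: consecutive_cubes_def diagonal)

lemma double_genus:
  "2 * int (genus (num_semigroup (consecutive_cubes n))) =
     1 + (a11 - 1) * (n - 1)^3 + (a22 - 1) * n^3 + (a33 - 1) * (n + 1)^3 - a11 * a22 * a33"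
  using rel.double_genus unfolding consecutive_cubes_def diagonal by simp

lemma frobenius_eq_if_le:
  assumes "a23 * (n + 1)^3 \<le> a32 * n^3"
  shows "frobenius (num_semigroup (consecutive_cubes n)) =
    - a12 * n^3 + a33 * (n + 1)^3 - (n - 1)^3 - n^3 - (n + 1)^3"
  using rel.frobenius_eq_if_le assms unfolding consecutive_cubes_def diagonal by simp

lemma frobenius_eq_if_ge:
  assumes "a32 * n^3 \<le> a23 * (n + 1)^3"
  shows "frobenius (num_semigroup (consecutive_cubes n)) =
    a22 * n^3 - a13 * (n + 1)^3 - (n - 1)^3 - n^3 - (n + 1)^3"
  using rel.frobenius_eq_if_ge assms unfolding consecutive_cubes_def diagonal by simp

text \<open>As \<open>n^3 \<le> (n + 1)^3\<close>, comparing the entries suffices. In the families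
  below \<open>a32 = -16\<close> and \<open>a23\<close> is linear in \<open>m\<close>, so the
  thresholds for \<open>m\<close> come from this comparison.\<close>

lemma frobenius_eq_if_entry_le:
  assumes "a23 \<le> a32" "0 \<le> n"
  shows "frobenius (num_semigroup (consecutive_cubes n)) =
    - a12 * n^3 + a33 * (n + 1)^3 - (n - 1)^3 - n^3 - (n + 1)^3"
proof (rule frobenius_eq_if_le)
  have "- a32 * n^3 \<le> - a23 * (n + 1)^3"
    using assms off_diagonal by (intro mult_mono power_mono) auto
  then show "a23 * (n + 1)^3 \<le> a32 * n^3" by simp
qed

end

section \<open>The two exceptional cases and the residue classes of even \<open>n\<close> modulo
  18\<close>

theorem mainTheorem5:
  fixes n :: int and d :: "int ^ 3"
  assumes "4 \<le> n" and "even n"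
  defines "d \<equiv> consecutive_cubes n"
  shows
    "(n = 4 \<longrightarrow>
        (\<forall>A. minimal_relation_matrix d A \<longleftrightarrow> A = vector [
           vector [7, -1, -1],
           vector [-1, 18, -9],
           vector [-6, -17, 10]]) \<and>
        int (genus (num_semigroup d)) =
          558 \<and>
        frobenius (num_semigroup d) =
          1098) \<and>
     (n = 6 \<longrightarrow>
        (\<forall>A. minimal_relation_matrix d A \<longleftrightarrow> A = vector [
           vector [31, -10, -5],
           vector [-6, 13, -6],
           vector [-25, -3, 11]]) \<and>
        int (genus (num_semigroup d)) =
          2670 \<and>
        frobenius (num_semigroup d) =
          5249) \<and>
     (\<forall>m\<ge>1. n = 18 * m \<longrightarrow>
        (\<forall>A. minimal_relation_matrix d A \<longleftrightarrow> A = vector [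
           vector [108 * m^2 + 55 * m + 1, -(108 * m^2 - 16 * m - 15), -(53 * m - 1)],
           vector [- m * (108 * m + 1), 108 * m^2 - 16 * m + 1, - m],
           vector [-(54 * m + 1), -16, 54 * m - 1]]) \<and>
        int (genus (num_semigroup d)) =
          314928 * m^5 + 110808 * m^4 + 16632 * m^3 + 532 * m^2 - 62 * m \<and>
        (m \<le> 15 \<longrightarrow> frobenius (num_semigroup d) =
           629856 * m^5 + 215784 * m^4 + 34020 * m^3 + 1890 * m^2 - 109 * m - 1) \<and>
        (m \<ge> 16 \<longrightarrow> frobenius (num_semigroup d) =
           629856 * m^5 + 221616 * m^4 - 58320 * m^3 + 1944 * m^2 - 108 * m - 1)) \<and>
     (\<forall>m\<ge>1. n = 18 * m + 2 \<longrightarrow>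
        (\<forall>A. minimal_relation_matrix d A \<longleftrightarrow> A = vector [
           vector [108 * m^2 + 37 * m + 3, -(108 * m^2 + 8 * m - 3), -(11 * m + 1)],
           vector [-(108 * m^2 - 17 * m - 4), 108 * m^2 + 8 * m + 13, -(43 * m + 4)],
           vector [-(54 * m + 7), -16, 54 * m + 5]]) \<and>
        int (genus (num_semigroup d)) =
          314928 * m^5 + 285768 * m^4 + 104760 * m^3 + 15244 * m^2 + 786 * m + 6 \<and>
        frobenius (num_semigroup d) =
          629856 * m^5 + 571536 * m^4 + 190512 * m^3 + 31752 * m^2 + 2548 * m + 75) \<and>
     (\<forall>m\<ge>1. n = 18 * m + 4 \<longrightarrow>
        (\<forall>A. minimal_relation_matrix d A \<longleftrightarrow> A = vector [
           vector [108 * m^2 + 55 * m + 7, -(108 * m^2 + 32 * m + 1), -(5 * m + 1)],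
           vector [-(108 * m^2 + m - 6), 108 * m^2 + 32 * m + 17, -(49 * m + 10)],
           vector [-(54 * m + 13), -16, 54 * m + 11]]) \<and>
        int (genus (num_semigroup d)) =
          314928 * m^5 + 460728 * m^4 + 270648 * m^3 + 77476 * m^2 + 10674 * m + 564 \<and>
        frobenius (num_semigroup d) =
          629856 * m^5 + 921456 * m^4 + 532656 * m^3 + 153144 * m^2 + 21812 * m + 1223) \<and>
     (\<forall>m\<ge>1. n = 18 * m + 6 \<longrightarrow>
        (\<forall>A. minimal_relation_matrix d A \<longleftrightarrow> A = vector [
           vector [108 * m^2 + 109 * m + 25, -(108 * m^2 + 56 * m - 3), -(35 * m + 11)],
           vector [-(108 * m^2 + 55 * m + 6), 108 * m^2 + 56 * m + 13, -(19 * m + 6)],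
           vector [-(54 * m + 19), -16, 54 * m + 17]]) \<and>
        int (genus (num_semigroup d)) =
          314928 * m^5 + 635688 * m^4 + 514296 * m^3 + 202780 * m^2 + 38434 * m + 2778 \<and>
        frobenius (num_semigroup d) =
          629856 * m^5 + 1271376 * m^4 + 968112 * m^3 + 355752 * m^2 + 63828 * m + 4499) \<and>
     (\<forall>m\<ge>0. n = 18 * m + 8 \<longrightarrow>
        (\<forall>A. minimal_relation_matrix d A \<longleftrightarrow> A = vector [
           vector [108 * m^2 + 145 * m + 44, -(108 * m^2 + 80 * m + 1), -(47 * m + 20)],
           vector [-(108 * m^2 + 91 * m + 19), 108 * m^2 + 80 * m + 17, -(7 * m + 3)],
           vector [-(54 * m + 25), -16, 54 * m + 23]]) \<and>
        int (genus (num_semigroup d)) =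
          314928 * m^5 + 810648 * m^4 + 835704 * m^3 + 428308 * m^2 + 108658 * m + 10888 \<and>
        (m \<in> {0, 1} \<longrightarrow> frobenius (num_semigroup d) =
           629856 * m^5 + 1580472 * m^4 + 1604772 * m^3 + 821178 * m^2 + 210979 * m + 21700) \<and>
        (m \<ge> 2 \<longrightarrow> frobenius (num_semigroup d) =
           629856 * m^5 + 1621296 * m^4 + 1590192 * m^3 + 753624 * m^2 + 173908 * m + 15695)) \<and>
     (\<forall>m\<ge>0. n = 18 * m + 10 \<longrightarrow>
        (\<forall>A. minimal_relation_matrix d A \<longleftrightarrow> A = vector [
           vector [108 * m^2 + 163 * m + 58, -(108 * m^2 + 104 * m + 13), -(41 * m + 22)],
           vector [-(108 * m^2 + 109 * m + 27), 108 * m^2 + 104 * m + 29, -(13 * m + 7)],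
           vector [-(54 * m + 31), -16, 54 * m + 29]]) \<and>
        int (genus (num_semigroup d)) =
          314928 * m^5 + 985608 * m^4 + 1234872 * m^3 + 769612 * m^2 + 237666 * m + 29022 \<and>
        (m = 0 \<longrightarrow> frobenius (num_semigroup d) =
           55222) \<and>
        (m \<ge> 1 \<longrightarrow> frobenius (num_semigroup d) =
           629856 * m^5 + 1971216 * m^4 + 2398896 * m^3 + 1429704 * m^2 + 419252 * m + 48539)) \<and>
     (\<forall>m\<ge>0. n = 18 * m + 12 \<longrightarrow>
        (\<forall>A. minimal_relation_matrix d A \<longleftrightarrow> A = vector [
           vector [108 * m^2 + 163 * m + 61, -(108 * m^2 + 128 * m + 33), -(17 * m + 11)],
           vector [-(108 * m^2 + 109 * m + 24), 108 * m^2 + 128 * m + 49, -(37 * m + 24)],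
           vector [-(54 * m + 37), -16, 54 * m + 35]]) \<and>
        int (genus (num_semigroup d)) =
          314928 * m^5 + 1160568 * m^4 + 1711800 * m^3 + 1257796 * m^2 + 459058 * m + 66444 \<and>
        frobenius (num_semigroup d) =
          629856 * m^5 + 2321136 * m^4 + 3394224 * m^3 + 2466936 * m^2 + 892404 * m + 128663) \<and>
     (\<forall>m\<ge>0. n = 18 * m + 14 \<longrightarrow>
        (\<forall>A. minimal_relation_matrix d A \<longleftrightarrow> A = vector [
           vector [108 * m^2 + 199 * m + 90, -(108 * m^2 + 152 * m + 45), -(29 * m + 22)],
           vector [-(108 * m^2 + 145 * m + 47), 108 * m^2 + 152 * m + 61, -(25 * m + 19)],
           vector [-(54 * m + 43), -16, 54 * m + 41]]) \<and>
        int (genus (num_semigroup d)) =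
          314928 * m^5 + 1335528 * m^4 + 2266488 * m^3 + 1917916 * m^2 + 807378 * m + 135042 \<and>
        frobenius (num_semigroup d) =
          629856 * m^5 + 2671056 * m^4 + 4482864 * m^3 + 3730536 * m^2 + 1541908 * m + 253539) \<and>
     (\<forall>m\<ge>0. n = 18 * m + 16 \<longrightarrow>
        (\<forall>A. minimal_relation_matrix d A \<longleftrightarrow> A = vector [
           vector [108 * m^2 + 217 * m + 108, -(108 * m^2 + 176 * m + 65), -(23 * m + 20)],
           vector [-(108 * m^2 + 163 * m + 59), 108 * m^2 + 176 * m + 81, -(31 * m + 27)],
           vector [-(54 * m + 49), -16, 54 * m + 47]]) \<and>
        int (genus (num_semigroup d)) =
          314928 * m^5 + 1510488 * m^4 + 2898936 * m^3 + 2776756 * m^2 + 1325266 * m + 251824 \<and>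
        frobenius (num_semigroup d) =
          629856 * m^5 + 3020976 * m^4 + 5758128 * m^3 + 5458968 * m^2 + 2576660 * m + 484767)"
  unfolding d_def
\<comment> \<open>Splitting conjunctions before entering the implications keeps the claims for one
  class together: two exceptional cases and nine families.\<close>
proof ((intro conjI; (intro allI impI)?), goal_cases)
  \<comment> \<open>The pattern for \<open>18 * m + 4\<close> at \<open>m = 0\<close> would have the
    positive off-diagonal entry \<open>a21 = 6\<close>.\<close>
  case 1
  have rel: "cube_relations n
    7 (-1) (-1)
    (-1) 18 (-9)
    (-6) (-17) 10"
    by unfold_locales (simp_all add: 1)
  \<comment> \<open>The entries \<open>-9\<close> and \<open>-17\<close> are in the wrong order for
    the entry comparison, but with the cubes \<open>17 * 64 < 9 * 125\<close>.\<close>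
  show ?case
    using cube_relations.minimal_relation_matrix_iff[OF rel] cube_relations.double_genus[OF rel]
      cube_relations.frobenius_eq_if_le[OF rel]
    by (simp add: 1)
next
  \<comment> \<open>The pattern for \<open>18 * m + 6\<close> at \<open>m = 0\<close> would have the
    positive off-diagonal entry \<open>a12 = 3\<close>.\<close>
  case 2
  have rel: "cube_relations n
    31 (-10) (-5)
    (-6) 13 (-6)
    (-25) (-3) 11"
    by unfold_locales (simp_all add: 2)
  show ?case
    using cube_relations.minimal_relation_matrix_iff[OF rel] cube_relations.double_genus[OF rel]
      cube_relations.frobenius_eq_if_le[OF rel]
    by (simp add: 2)
next
  case (3 m)
  note m = this(1) and n = this(2)
  \<comment> \<open>With \<open>m^2\<close> treated as an atom, this bound makes the signs of the
    quadratic entries linear consequences.\<close>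
  have "m \<le> m^2"
    using m by (cases "m = 0") (auto simp: power2_eq_square)
  have rel: "cube_relations n
    (108 * m^2 + 55 * m + 1) (-(108 * m^2 - 16 * m - 15)) (-(53 * m - 1))
    (- m * (108 * m + 1)) (108 * m^2 - 16 * m + 1) (- m)
    (-(54 * m + 1)) (-16) (54 * m - 1)"
    \<comment> \<open>Minors and column sums are polynomial identities; signs follow linearly, or
      from the factors for the entry written as a product. The \<open>fail\<close> rejects a
      simplification that does not close its goal.\<close>
    by unfold_locales
      ((use m in \<open>simp add: n algebra_simps power2_eq_square power3_eq_cube; fail\<close>)
        | (use m \<open>m \<le> m^2\<close> in linarith)
        | (rule mult_neg_pos; use m in simp))+
  show ?case
  proof (intro conjI impI cube_relations.minimal_relation_matrix_iff[OF rel], goal_cases)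
    case 1
    show ?case
      using cube_relations.double_genus[OF rel]
      by (simp add: n algebra_simps eval_nat_numeral)
  next
    case 2
    then have "m \<in> set [1..15]"
      using m by simp
    then show ?case
      using cube_relations.frobenius_eq_if_ge[OF rel] by (auto simp: n upto_rec1)
  next
    \<comment> \<open>From \<open>16 \<le> m\<close> on, \<open>a23 = - m\<close> is at most
      \<open>a32 = -16\<close>.\<close>
    case 3
    then show ?case
      using cube_relations.frobenius_eq_if_entry_le[OF rel]
      by (simp add: n algebra_simps eval_nat_numeral)
  qed
next
  case (4 m)
  note m = this(1) and n = this(2)
  have "m \<le> m^2"
    using m by (cases "m = 0") (auto simp: power2_eq_square)
  have rel: "cube_relations n
    (108 * m^2 + 37 * m + 3) (-(108 * m^2 + 8 * m - 3)) (-(11 * m + 1))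
    (-(108 * m^2 - 17 * m - 4)) (108 * m^2 + 8 * m + 13) (-(43 * m + 4))
    (-(54 * m + 7)) (-16) (54 * m + 5)"
    by unfold_locales
      ((use m in \<open>simp add: n algebra_simps power2_eq_square power3_eq_cube; fail\<close>)
        | (use m \<open>m \<le> m^2\<close> in linarith))+
  \<comment> \<open>Here \<open>43 * m + 4\<close> exceeds 16 for all \<open>1 \<le> m\<close>, so
    one corner wins throughout; likewise in every family with a single Frobenius formula.\<close>
  show ?case
    by (intro conjI cube_relations.minimal_relation_matrix_iff[OF rel])
      (use m cube_relations.double_genus[OF rel] cube_relations.frobenius_eq_if_entry_le[OF rel] in
        \<open>simp_all add: n algebra_simps eval_nat_numeral\<close>)
next
  case (5 m)
  note m = this(1) and n = this(2)
  have "m \<le> m^2"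
    using m by (cases "m = 0") (auto simp: power2_eq_square)
  have rel: "cube_relations n
    (108 * m^2 + 55 * m + 7) (-(108 * m^2 + 32 * m + 1)) (-(5 * m + 1))
    (-(108 * m^2 + m - 6)) (108 * m^2 + 32 * m + 17) (-(49 * m + 10))
    (-(54 * m + 13)) (-16) (54 * m + 11)"
    by unfold_locales
      ((use m in \<open>simp add: n algebra_simps power2_eq_square power3_eq_cube; fail\<close>)
        | (use m \<open>m \<le> m^2\<close> in linarith))+
  show ?case
    by (intro conjI cube_relations.minimal_relation_matrix_iff[OF rel])
      (use m cube_relations.double_genus[OF rel] cube_relations.frobenius_eq_if_entry_le[OF rel] in
        \<open>simp_all add: n algebra_simps eval_nat_numeral\<close>)
next
  case (6 m)
  note m = this(1) and n = this(2)
  have "m \<le> m^2"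
    using m by (cases "m = 0") (auto simp: power2_eq_square)
  have rel: "cube_relations n
    (108 * m^2 + 109 * m + 25) (-(108 * m^2 + 56 * m - 3)) (-(35 * m + 11))
    (-(108 * m^2 + 55 * m + 6)) (108 * m^2 + 56 * m + 13) (-(19 * m + 6))
    (-(54 * m + 19)) (-16) (54 * m + 17)"
    by unfold_locales
      ((use m in \<open>simp add: n algebra_simps power2_eq_square power3_eq_cube; fail\<close>)
        | (use m \<open>m \<le> m^2\<close> in linarith))+
  show ?case
    by (intro conjI cube_relations.minimal_relation_matrix_iff[OF rel])
      (use m cube_relations.double_genus[OF rel] cube_relations.frobenius_eq_if_entry_le[OF rel] in
        \<open>simp_all add: n algebra_simps eval_nat_numeral\<close>)
next
  case (7 m)
  note m = this(1) and n = this(2)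
  have "m \<le> m^2"
    using m by (cases "m = 0") (auto simp: power2_eq_square)
  have rel: "cube_relations n
    (108 * m^2 + 145 * m + 44) (-(108 * m^2 + 80 * m + 1)) (-(47 * m + 20))
    (-(108 * m^2 + 91 * m + 19)) (108 * m^2 + 80 * m + 17) (-(7 * m + 3))
    (-(54 * m + 25)) (-16) (54 * m + 23)"
    by unfold_locales
      ((use m in \<open>simp add: n algebra_simps power2_eq_square power3_eq_cube; fail\<close>)
        | (use m \<open>m \<le> m^2\<close> in linarith))+
  show ?case
  proof (intro conjI impI cube_relations.minimal_relation_matrix_iff[OF rel], goal_cases)
    case 1
    show ?case
      using cube_relations.double_genus[OF rel]
      by (simp add: n algebra_simps eval_nat_numeral)
  next
    \<comment> \<open>\<open>7 * m + 3\<close> is 3 or 10, below 16, and the corners are compared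
      numerically; from \<open>m = 2\<close> on it exceeds 16.\<close>
    case 2
    then show ?case
      using cube_relations.frobenius_eq_if_ge[OF rel] by (auto simp: n)
  next
    case 3
    then show ?case
      using cube_relations.frobenius_eq_if_entry_le[OF rel]
      by (simp add: n algebra_simps eval_nat_numeral)
  qed
next
  case (8 m)
  note m = this(1) and n = this(2)
  have "m \<le> m^2"
    using m by (cases "m = 0") (auto simp: power2_eq_square)
  have rel: "cube_relations n
    (108 * m^2 + 163 * m + 58) (-(108 * m^2 + 104 * m + 13)) (-(41 * m + 22))
    (-(108 * m^2 + 109 * m + 27)) (108 * m^2 + 104 * m + 29) (-(13 * m + 7))
    (-(54 * m + 31)) (-16) (54 * m + 29)"
    by unfold_locales
      ((use m in \<open>simp add: n algebra_simps power2_eq_square power3_eq_cube; fail\<close>)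
        | (use m \<open>m \<le> m^2\<close> in linarith))+
  show ?case
  proof (intro conjI impI cube_relations.minimal_relation_matrix_iff[OF rel], goal_cases)
    case 1
    show ?case
      using cube_relations.double_genus[OF rel]
      by (simp add: n algebra_simps eval_nat_numeral)
  next
    \<comment> \<open>At \<open>m = 0\<close> the corner comparison is
      \<open>7 * 11^3 \<le> 16 * 10^3\<close>; from \<open>m = 1\<close> on
      \<open>13 * m + 7\<close> exceeds 16.\<close>
    case 2
    then show ?case
      using cube_relations.frobenius_eq_if_ge[OF rel] by (simp add: n)
  next
    case 3
    then show ?case
      using cube_relations.frobenius_eq_if_entry_le[OF rel]
      by (simp add: n algebra_simps eval_nat_numeral)
  qed
next
  case (9 m)
  note m = this(1) and n = this(2)
  have "m \<le> m^2"
    using m by (cases "m = 0") (auto simp: power2_eq_square)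
  have rel: "cube_relations n
    (108 * m^2 + 163 * m + 61) (-(108 * m^2 + 128 * m + 33)) (-(17 * m + 11))
    (-(108 * m^2 + 109 * m + 24)) (108 * m^2 + 128 * m + 49) (-(37 * m + 24))
    (-(54 * m + 37)) (-16) (54 * m + 35)"
    by unfold_locales
      ((use m in \<open>simp add: n algebra_simps power2_eq_square power3_eq_cube; fail\<close>)
        | (use m \<open>m \<le> m^2\<close> in linarith))+
  show ?case
    by (intro conjI cube_relations.minimal_relation_matrix_iff[OF rel])
      (use m cube_relations.double_genus[OF rel] cube_relations.frobenius_eq_if_entry_le[OF rel] in
        \<open>simp_all add: n algebra_simps eval_nat_numeral\<close>)
next
  case (10 m)
  note m = this(1) and n = this(2)
  have "m \<le> m^2"
    using m by (cases "m = 0") (auto simp: power2_eq_square)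
  have rel: "cube_relations n
    (108 * m^2 + 199 * m + 90) (-(108 * m^2 + 152 * m + 45)) (-(29 * m + 22))
    (-(108 * m^2 + 145 * m + 47)) (108 * m^2 + 152 * m + 61) (-(25 * m + 19))
    (-(54 * m + 43)) (-16) (54 * m + 41)"
    by unfold_locales
      ((use m in \<open>simp add: n algebra_simps power2_eq_square power3_eq_cube; fail\<close>)
        | (use m \<open>m \<le> m^2\<close> in linarith))+
  show ?case
    by (intro conjI cube_relations.minimal_relation_matrix_iff[OF rel])
      (use m cube_relations.double_genus[OF rel] cube_relations.frobenius_eq_if_entry_le[OF rel] in
        \<open>simp_all add: n algebra_simps eval_nat_numeral\<close>)
next
  case (11 m)
  note m = this(1) and n = this(2)
  have "m \<le> m^2"
    using m by (cases "m = 0") (auto simp: power2_eq_square)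
  have rel: "cube_relations n
    (108 * m^2 + 217 * m + 108) (-(108 * m^2 + 176 * m + 65)) (-(23 * m + 20))
    (-(108 * m^2 + 163 * m + 59)) (108 * m^2 + 176 * m + 81) (-(31 * m + 27))
    (-(54 * m + 49)) (-16) (54 * m + 47)"
    by unfold_locales
      ((use m in \<open>simp add: n algebra_simps power2_eq_square power3_eq_cube; fail\<close>)
        | (use m \<open>m \<le> m^2\<close> in linarith))+
  show ?case
    by (intro conjI cube_relations.minimal_relation_matrix_iff[OF rel])
      (use m cube_relations.double_genus[OF rel] cube_relations.frobenius_eq_if_entry_le[OF rel] in
        \<open>simp_all add: n algebra_simps eval_nat_numeral\<close>)
qed

end
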